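(* Let $n\ge 2$ and let $\pi\in\mathfrak{S}_n$, also regarded as its $n\times n$ permutation matrix $(\pi_{a,b})$. Let $P$ be the $(n-1)\times(n-1)$ matrix of $\pi$ expressed in root coordinates, let $C$ be the $(n-1)\times(n-1)$ Cartan matrix of type $A_{n-1}$, and let $D$ be the $(n-1)\times(n-1)$ matrix $$D_{i,j}=\begin{cases}\displaystyle\sum_{a\le i,\ b>j}\pi_{a,b} & i\le j,\\[2mm] \displaystyle\sum_{a>i,\ b\le j}\pi_{a,b} & i\ge j.\end{cases}$$ Then $I-P=DC$.
   Context: The symmetric group $\mathfrak{S}_n$ acts on $\mathbb{R}^n$ by permutation matrices acting on column vectors, and $\pi_{a,b}=1$ if and only if $\pi e_b=e_a$ (all other entries are $0$). The simple roots of $A_{n-1}$ are $\alpha_i=e_i-e_{i+1}$, $1\le i\le n-1$; their span (vectors with coordinate sum zero) is invariant under $\mathfrak{S}_n$, giving the reflection representation. "$\pi$ expressed in root coordinates" means the matrix of $\pi$ acting on this span with respect to the basis $(\alpha_1,\dots,\alpha_{n-1})$. The Cartan matrix is $C_{i,j}=2(\alpha_i,\alpha_j)/(\alpha_i,\alpha_i)$, i.e. it has $2$ on the diagonal, $-1$ on the super- and subdiagonal, and $0$ elsewhere. In the sums, $a,b$ range over $\{1,\dots,n\}$. For $i=j$ the two formulas for $D_{i,j}$ agree. *)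

theory Defs
  imports "Jordan_Normal_Form.Matrix" "HOL-Combinatorics.Permutations"
begin

text \<open>
  Indices start at 0: the symmetric group consists of the permutations of
  \<open>{..<n}\<close>, the standard basis vectors are \<open>e\<^sub>0, \<dots>, e\<^sub>n\<^sub>-\<^sub>1\<close>, and the simple roots are
  \<open>\<alpha>\<^sub>0, \<dots>, \<alpha>\<^sub>n\<^sub>-\<^sub>2\<close>. This shifts every index of the 1-based convention down by one, so
  inequalities between indices are unaffected.
\<close>

definition perm_matrix :: "nat \<Rightarrow> (nat \<Rightarrow> nat) \<Rightarrow> real mat" where
  "perm_matrix n \<pi> = mat n n (\<lambda>(a, b). if \<pi> b = a then 1 else 0)"

definition simple_root :: "nat \<Rightarrow> nat \<Rightarrow> real vec" where
  "simple_root n i = unit_vec n i - unit_vec n (i + 1)"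

definition represents_in_roots :: "nat \<Rightarrow> real mat \<Rightarrow> real mat \<Rightarrow> bool" where
  "represents_in_roots n P A \<longleftrightarrow>
     P \<in> carrier_mat (n - 1) (n - 1) \<and>
     (\<forall>j<n - 1. A *\<^sub>v simple_root n j =
        finsum_vec TYPE(real) n (\<lambda>i. P $$ (i, j) \<cdot>\<^sub>v simple_root n i) {..<n - 1})"

text \<open>
  The definite description is justified for permutation matrices by
  \<open>ex1_represents_in_roots\<close> below.
\<close>

definition root_coordinate_matrix :: "nat \<Rightarrow> real mat \<Rightarrow> real mat" where
  "root_coordinate_matrix n A = (THE P. represents_in_roots n P A)"

definition cartan_matrix :: "nat \<Rightarrow> real mat" where
  "cartan_matrix n = mat (n - 1) (n - 1) (\<lambda>(i, j).
     2 * (simple_root n i \<bullet> simple_root n j) / (simple_root n i \<bullet> simple_root n i))"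

text \<open>
  The two formulas (for \<open>i \<le> j\<close> and \<open>i \<ge> j\<close>) overlap at \<open>i = j\<close>, where they agree; see
  \<open>crossing_sums_agree\<close>.
\<close>

definition crossing_matrix :: "nat \<Rightarrow> (nat \<Rightarrow> nat) \<Rightarrow> real mat" where
  "crossing_matrix n \<pi> = mat (n - 1) (n - 1) (\<lambda>(i, j).
     if i \<le> j then \<Sum>a\<in>{a. a < n \<and> a \<le> i}. \<Sum>b\<in>{b. b < n \<and> b > j}. perm_matrix n \<pi> $$ (a, b)
     else \<Sum>a\<in>{a. a < n \<and> a > i}. \<Sum>b\<in>{b. b < n \<and> b \<le> j}. perm_matrix n \<pi> $$ (a, b))"

lemma simple_root_carrier [simp]: "simple_root n i \<in> carrier_vec n"
  by (simp add: simple_root_def)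

lemma cartan_matrix_entry:
  assumes "i < n - 1" "j < n - 1"
  shows "cartan_matrix n $$ (i, j) =
    (if i = j then 2 else if j = i + 1 \<or> i = j + 1 then -1 else 0)"
proof -
  have ip: "simple_root n k \<bullet> simple_root n l =
      (if k = l then 2 else if l = k + 1 \<or> k = l + 1 then -1 else 0)"
    if "k < n - 1" "l < n - 1" for k l
  proof -
    have "simple_root n k \<bullet> simple_root n l = simple_root n l $ k - simple_root n l $ (k + 1)"
      using that unfolding simple_root_def[of n k]
      by (subst minus_scalar_prod_distrib[of _ n]) (auto simp: scalar_prod_left_unit)
    then show ?thesis
      using that by (auto simp: simple_root_def)
  qed
  show ?thesis
    using assms ip[of i j] ip[of i i] by (simp add: cartan_matrix_def)
qed

lemma root_combination_entry:
  assumes "k < n"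
  shows "finsum_vec TYPE(real) n (\<lambda>i. c i \<cdot>\<^sub>v simple_root n i) {..<n - 1} $ k =
    (if k < n - 1 then c k else 0) - (if k = 0 then 0 else c (k - 1))"
proof -
  have "finsum_vec TYPE(real) n (\<lambda>i. c i \<cdot>\<^sub>v simple_root n i) {..<n - 1} $ k =
      (\<Sum>i<n - 1. (c i \<cdot>\<^sub>v simple_root n i) $ k)"
    using assms by (intro index_finsum_vec) auto
  also have "\<dots> = (\<Sum>i<n - 1. (if i = k then c i else 0) -
      (if i = k - 1 then if k = 0 then 0 else c i else 0))"
    using assms by (intro sum.cong) (auto simp: simple_root_def)
  also have "\<dots> = (if k < n - 1 then c k else 0) - (if k = 0 then 0 else c (k - 1))"
    using assms by (auto simp: sum_subtractf)
  finally show ?thesis .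
qed

lemma root_combination_eq_iff:
  assumes v: "v \<in> carrier_vec n" and n: "n \<ge> 1" and s: "(\<Sum>k<n. v $ k) = 0"
  shows "v = finsum_vec TYPE(real) n (\<lambda>i. c i \<cdot>\<^sub>v simple_root n i) {..<n - 1} \<longleftrightarrow>
    (\<forall>i<n - 1. c i = (\<Sum>k\<le>i. v $ k))" (is "v = ?w \<longleftrightarrow> _")
proof
  assume eq: "v = ?w"
  have e: "v $ k = (if k < n - 1 then c k else 0) - (if k = 0 then 0 else c (k - 1))"
    if "k < n" for k
    using root_combination_entry[OF that, of c] eq by simp
  have "i < n - 1 \<longrightarrow> c i = (\<Sum>k\<le>i. v $ k)" for i
    by (induction i) (use e in auto)
  then show "\<forall>i<n - 1. c i = (\<Sum>k\<le>i. v $ k)"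
    by blast
next
  assume c: "\<forall>i<n - 1. c i = (\<Sum>k\<le>i. v $ k)"
  show "v = ?w"
  proof (rule eq_vecI)
    have w: "?w \<in> carrier_vec n"
      by (rule finsum_vec_closed) auto
    then show "dim_vec v = dim_vec ?w"
      using v by simp
    fix k assume "k < dim_vec ?w"
    then have k: "k < n"
      using w by simp
    obtain m where m: "n = Suc m"
      using n by (cases n) auto
    have "(\<Sum>k<m. v $ k) + v $ m = 0"
      using s m by simp
    then show "v $ k = ?w $ k"
      unfolding root_combination_entry[OF k]
      using c k m by (cases k) (auto simp: lessThan_Suc_atMost less_Suc_eq)
  qed
qed

lemma perm_matrix_column_sum:
  assumes "\<pi> permutes {..<n}" "b < n"
  shows "(\<Sum>a<n. perm_matrix n \<pi> $$ (a, b)) = 1"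
  using assms permutes_in_image[OF assms(1), of b] by (simp add: perm_matrix_def)

lemma perm_matrix_row_sum:
  assumes \<pi>: "\<pi> permutes {..<n}" and a: "a < n"
  shows "(\<Sum>b<n. perm_matrix n \<pi> $$ (a, b)) = 1"
proof -
  have "(\<Sum>b<n. perm_matrix n \<pi> $$ (a, b)) = (\<Sum>b<n. if b = inv_into UNIV \<pi> a then 1 else 0)"
    using a \<pi> by (intro sum.cong) (auto simp: perm_matrix_def permutes_inv_eq permutes_inverses)
  then show ?thesis
    using permutes_in_image[OF permutes_inv[OF \<pi>], of a] a by simp
qed

lemma perm_matrix_mult_root_sum:
  assumes \<pi>: "\<pi> permutes {..<n}" and j: "j < n - 1"
  shows "(\<Sum>k<n. (perm_matrix n \<pi> *\<^sub>v simple_root n j) $ k) = 0"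
proof -
  have A: "perm_matrix n \<pi> \<in> carrier_mat n n"
    by (simp add: perm_matrix_def)
  have "(perm_matrix n \<pi> *\<^sub>v simple_root n j) $ k =
      perm_matrix n \<pi> $$ (k, j) - perm_matrix n \<pi> $$ (k, j + 1)" if "k < n" for k
    using that j A
    by (simp add: simple_root_def scalar_prod_minus_distrib[of _ n] scalar_prod_right_unit)
  then have "(\<Sum>k<n. (perm_matrix n \<pi> *\<^sub>v simple_root n j) $ k) =
      (\<Sum>k<n. perm_matrix n \<pi> $$ (k, j)) - (\<Sum>k<n. perm_matrix n \<pi> $$ (k, j + 1))"
    by (simp add: sum_subtractf)
  then show ?thesis
    using j perm_matrix_column_sum[OF \<pi>, of j] perm_matrix_column_sum[OF \<pi>, of "j + 1"] by simp
qed

lemma ex1_represents_in_roots: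
  assumes \<pi>: "\<pi> permutes {..<n}" and n: "n \<ge> 1"
  shows "\<exists>!P. represents_in_roots n P (perm_matrix n \<pi>)"
proof -
  let ?v = "\<lambda>j. perm_matrix n \<pi> *\<^sub>v simple_root n j"
  have v: "?v j \<in> carrier_vec n" for j
    by (rule mult_mat_vec_carrier[of _ n n]) (auto simp: perm_matrix_def)
  have iff: "represents_in_roots n P (perm_matrix n \<pi>) \<longleftrightarrow>
      P = mat (n - 1) (n - 1) (\<lambda>(i, j). \<Sum>k\<le>i. ?v j $ k)" for P
    unfolding represents_in_roots_def
    using root_combination_eq_iff[OF v n perm_matrix_mult_root_sum[OF \<pi>]]
    by (auto simp: mat_eq_iff)
  then show ?thesis
    by simp
qed

lemma crossing_sums_agree:
  assumes \<pi>: "\<pi> permutes {..<n}" and i: "i < n - 1"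
  shows "(\<Sum>a\<in>{a. a < n \<and> a \<le> i}. \<Sum>b\<in>{b. b < n \<and> b > i}. perm_matrix n \<pi> $$ (a, b)) =
    (\<Sum>a\<in>{a. a < n \<and> a > i}. \<Sum>b\<in>{b. b < n \<and> b \<le> i}. perm_matrix n \<pi> $$ (a, b))"
proof -
  let ?L = "{a. a < n \<and> a \<le> i}" and ?H = "{a. a < n \<and> a > i}"
  let ?p = "\<lambda>a b. perm_matrix n \<pi> $$ (a, b)"
  have split: "(\<Sum>a<n. f a) = sum f ?L + sum f ?H" for f :: "nat \<Rightarrow> real"
    by (subst sum.union_disjoint[symmetric]) (auto intro!: sum.cong)
  have "(\<Sum>a\<in>?L. \<Sum>b<n. ?p a b) = (\<Sum>b\<in>?L. \<Sum>a<n. ?p a b)"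
    by (simp add: perm_matrix_row_sum[OF \<pi>] perm_matrix_column_sum[OF \<pi>])
  then have "(\<Sum>a\<in>?L. \<Sum>b\<in>?L. ?p a b) + (\<Sum>a\<in>?L. \<Sum>b\<in>?H. ?p a b) =
      (\<Sum>b\<in>?L. \<Sum>a\<in>?L. ?p a b) + (\<Sum>b\<in>?L. \<Sum>a\<in>?H. ?p a b)"
    by (simp add: split sum.distrib)
  then show ?thesis
    using sum.swap[of ?p ?L ?L] sum.swap[of ?p ?L ?H] by simp
qed

end

theory Submission
  imports Defs
begin

text \<open>
  Write \<open>S i j\<close> for the sum of the entries of \<open>\<pi>\<close> in its first \<open>i\<close> rows and first \<open>j\<close> columns,
  with \<open>0 \<le> i, j \<le> n\<close>. Since every row and every column of \<open>\<pi>\<close> sums to one, the sum over the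
  entries of these rows \<^emph>\<open>outside\<close> these columns is \<open>i - S i j\<close>, and the sum over the entries of
  these columns outside these rows is \<open>j - S i j\<close>. Hence both branches of the definition of \<open>D\<close>
  are one formula, \<open>D = min i j - S i j\<close> up to the index shift
  (\<open>crossing_matrix_entry\<close>).

  This expression makes sense on the larger range \<open>0, \<dots>, n\<close> of the column index, and it
  vanishes at both ends. Multiplying on the right by the tridiagonal matrix \<open>C\<close> is therefore the
  same as taking the negative second difference in the column index, with no boundary correction
  (\<open>sum_mult_cartan_matrix\<close>). The second difference acts separately on the two terms:
  on \<open>min i j\<close>, which is piecewise linear with a kink at \<open>i = j\<close>, it yields the identity matrix;
  on \<open>S i j\<close> it yields the difference of two adjacent columns of \<open>\<pi>\<close> summed over the first rows.
  The latter is \<open>P\<close> (\<open>root_coordinate_matrix_perm\<close>), because the coefficient of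
  \<open>\<alpha>\<^sub>i\<close> in a vector of coordinate sum zero is the sum of its coordinates up to the \<open>i\<close>-th, and
  \<open>\<pi>\<close> maps \<open>\<alpha>\<^sub>j\<close> to the difference of its columns \<open>j\<close> and \<open>j + 1\<close>.
\<close>

definition corner_sum :: "nat \<Rightarrow> (nat \<Rightarrow> nat) \<Rightarrow> nat \<Rightarrow> nat \<Rightarrow> real" where
  "corner_sum n \<pi> i j = (\<Sum>a<i. \<Sum>b<j. perm_matrix n \<pi> $$ (a, b))"

lemma corner_sum_0 [simp]: "corner_sum n \<pi> i 0 = 0"
  by (simp add: corner_sum_def)

lemma corner_sum_Suc:
  "corner_sum n \<pi> i (Suc j) = corner_sum n \<pi> i j + (\<Sum>a<i. perm_matrix n \<pi> $$ (a, j))"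
  by (simp add: corner_sum_def sum.distrib)

lemma corner_sum_all_columns:
  assumes "\<pi> permutes {..<n}" "i \<le> n"
  shows "corner_sum n \<pi> i n = real i"
  using assms by (simp add: corner_sum_def perm_matrix_row_sum)

lemma sum_lessThan_complement:
  fixes f :: "nat \<Rightarrow> 'a::ab_group_add"
  assumes "j < n"
  shows "sum f {b. b < n \<and> b > j} = sum f {..<n} - sum f {..<Suc j}"
proof -
  have "{b. b < n \<and> b > j} = {..<n} - {..<Suc j}"
    by auto
  then have "sum f {b. b < n \<and> b > j} = sum f ({..<n} - {..<Suc j})"
    by (rule arg_cong)
  also have "\<dots> = sum f {..<n} - sum f {..<Suc j}"
    using assms by (intro sum_diff) auto
  finally show ?thesis .
qed

text \<open>
  Entries of the first rows lying outside the first columns are counted by removing the corner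
  from full rows, and dually for columns; the branch condition \<open>i \<le> j\<close> only decides which of
  \<open>i + 1\<close> and \<open>j + 1\<close> is the minimum.
\<close>

lemma crossing_matrix_entry:
  assumes \<pi>: "\<pi> permutes {..<n}" and ij: "i < n - 1" "j < n - 1"
  shows "crossing_matrix n \<pi> $$ (i, j) =
    real (min (Suc i) (Suc j)) - corner_sum n \<pi> (Suc i) (Suc j)"
proof -
  let ?p = "\<lambda>a b. perm_matrix n \<pi> $$ (a, b)"
  have low: "{a. a < n \<and> a \<le> k} = {..<Suc k}" if "k < n - 1" for k
    using that by auto
  show ?thesis
  proof (cases "i \<le> j")
    case True
    have "crossing_matrix n \<pi> $$ (i, j) =
        (\<Sum>a<Suc i. (\<Sum>b<n. ?p a b) - (\<Sum>b<Suc j. ?p a b))"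
      using True ij
      by (simp add: crossing_matrix_def low sum_lessThan_complement del: sum.lessThan_Suc)
    also have "\<dots> = (\<Sum>a<Suc i. 1 - (\<Sum>b<Suc j. ?p a b))"
      using ij perm_matrix_row_sum[OF \<pi>] by (intro sum.cong) auto
    also have "\<dots> = real (Suc i) - corner_sum n \<pi> (Suc i) (Suc j)"
      by (simp add: corner_sum_def sum_subtractf del: sum.lessThan_Suc)
    finally show ?thesis
      using True by simp
  next
    case False
    have "crossing_matrix n \<pi> $$ (i, j) =
        (\<Sum>a\<in>{a. a < n \<and> a > i}. \<Sum>b<Suc j. ?p a b)"
      using False ij by (simp add: crossing_matrix_def low del: sum.lessThan_Suc)
    also have "\<dots> = (\<Sum>b<Suc j. \<Sum>a\<in>{a. a < n \<and> a > i}. ?p a b)"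
      by (rule sum.swap)
    also have "\<dots> = (\<Sum>b<Suc j. (\<Sum>a<n. ?p a b) - (\<Sum>a<Suc i. ?p a b))"
      using ij by (simp add: sum_lessThan_complement del: sum.lessThan_Suc)
    also have "\<dots> = (\<Sum>b<Suc j. 1 - (\<Sum>a<Suc i. ?p a b))"
      using ij perm_matrix_column_sum[OF \<pi>] by (intro sum.cong) auto
    also have "\<dots> = real (Suc j) - (\<Sum>b<Suc j. \<Sum>a<Suc i. ?p a b)"
      by (simp add: sum_subtractf del: sum.lessThan_Suc)
    also have "(\<Sum>b<Suc j. \<Sum>a<Suc i. ?p a b) = corner_sum n \<pi> (Suc i) (Suc j)"
      unfolding corner_sum_def by (rule sum.swap)
    finally show ?thesis
      using False by simp
  qed
qed

text \<open>
  The image of a simple root again has coordinate sum zero, so its root coordinates are its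
  partial coordinate sums; those of a difference of two columns of \<open>\<pi>\<close> split column by column.
\<close>

lemma root_coordinate_matrix_perm:
  assumes \<pi>: "\<pi> permutes {..<n}" and n: "n \<ge> 1"
  shows "root_coordinate_matrix n (perm_matrix n \<pi>) = mat (n - 1) (n - 1) (\<lambda>(i, j).
    (\<Sum>a<Suc i. perm_matrix n \<pi> $$ (a, j)) - (\<Sum>a<Suc i. perm_matrix n \<pi> $$ (a, Suc j)))"
    (is "_ = ?P")
proof -
  have A: "perm_matrix n \<pi> \<in> carrier_mat n n"
    by (simp add: perm_matrix_def)
  have v: "perm_matrix n \<pi> *\<^sub>v simple_root n j \<in> carrier_vec n" for j
    using A by (rule mult_mat_vec_carrier) simp
  have image: "(perm_matrix n \<pi> *\<^sub>v simple_root n j) $ k =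
      perm_matrix n \<pi> $$ (k, j) - perm_matrix n \<pi> $$ (k, Suc j)"
    if "k < n" "j < n - 1" for k j
    using that A
    by (simp add: simple_root_def scalar_prod_minus_distrib[of _ n] scalar_prod_right_unit)
  have "represents_in_roots n ?P (perm_matrix n \<pi>)"
    unfolding represents_in_roots_def
  proof (intro conjI allI impI)
    fix j assume j: "j < n - 1"
    have "?P $$ (i, j) = (\<Sum>k\<le>i. (perm_matrix n \<pi> *\<^sub>v simple_root n j) $ k)"
      if "i < n - 1" for i
      using that j
      by (simp add: image sum_subtractf lessThan_Suc_atMost del: sum.lessThan_Suc sum.atMost_Suc)
    then show "perm_matrix n \<pi> *\<^sub>v simple_root n j =
        finsum_vec TYPE(real) n (\<lambda>i. ?P $$ (i, j) \<cdot>\<^sub>v simple_root n i) {..<n - 1}"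
      by (intro root_combination_eq_iff[OF v n perm_matrix_mult_root_sum[OF \<pi> j], THEN iffD2])
        blast
  qed simp
  then show ?thesis
    unfolding root_coordinate_matrix_def
    by (rule the1_equality[OF ex1_represents_in_roots[OF \<pi> n]])
qed

text \<open>
  The matrix \<open>C\<close> is the negative discrete Laplacian with Dirichlet boundary conditions: for a
  sequence vanishing at \<open>0\<close> and \<open>n\<close> the neighbours missing in its first and last column
  contribute nothing.
\<close>

lemma sum_mult_cartan_matrix:
  fixes d :: "nat \<Rightarrow> real"
  assumes "d 0 = 0" "d n = 0" and j: "j < n - 1"
  shows "(\<Sum>k<n - 1. d (Suc k) * cartan_matrix n $$ (k, j)) =
    2 * d (Suc j) - d j - d (Suc (Suc j))"
proof -
  \<comment> \<open>For \<open>j = 0\<close> the truncated \<open>j - 1\<close> equals \<open>j\<close>, but then the second term is \<open>d 0 = 0\<close>.\<close>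
  have "(\<Sum>k<n - 1. d (Suc k) * cartan_matrix n $$ (k, j)) =
      (\<Sum>k<n - 1. (if k = j then 2 * d (Suc j) else 0)
        - (if k = j - 1 then d j else 0)
        - (if k = Suc j then d (Suc (Suc j)) else 0))"
    using assms by (intro sum.cong) (auto simp: cartan_matrix_entry)
  also have "\<dots> = 2 * d (Suc j) - d j - (if Suc j < n - 1 then d (Suc (Suc j)) else 0)"
    using j by (simp add: sum_subtractf)
  also have "(if Suc j < n - 1 then d (Suc (Suc j)) else 0) = d (Suc (Suc j))"
  proof (cases "Suc j < n - 1")
    case False
    then have "Suc (Suc j) = n"
      using j by simp
    then show ?thesis
      using \<open>d n = 0\<close> by simp
  qed simp
  finally show ?thesis .
qed

theorem theorem3:
  fixes n :: nat and \<pi> :: "nat \<Rightarrow> nat"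
  assumes "n \<ge> 2" and "\<pi> permutes {..<n}"
  shows "1\<^sub>m (n - 1) - root_coordinate_matrix n (perm_matrix n \<pi>) =
    crossing_matrix n \<pi> * cartan_matrix n"
proof (rule eq_matI)
  have n: "n \<ge> 1" and \<pi>: "\<pi> permutes {..<n}"
    using assms by simp_all
  have dims: "crossing_matrix n \<pi> \<in> carrier_mat (n - 1) (n - 1)"
    "cartan_matrix n \<in> carrier_mat (n - 1) (n - 1)"
    by (simp_all add: crossing_matrix_def cartan_matrix_def)
  show "dim_row (1\<^sub>m (n - 1) - root_coordinate_matrix n (perm_matrix n \<pi>)) =
      dim_row (crossing_matrix n \<pi> * cartan_matrix n)"
    "dim_col (1\<^sub>m (n - 1) - root_coordinate_matrix n (perm_matrix n \<pi>)) =
      dim_col (crossing_matrix n \<pi> * cartan_matrix n)"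
    using dims by (simp_all add: root_coordinate_matrix_perm[OF \<pi> n])
  fix i j
  assume "i < dim_row (crossing_matrix n \<pi> * cartan_matrix n)"
    and "j < dim_col (crossing_matrix n \<pi> * cartan_matrix n)"
  then have i: "i < n - 1" and j: "j < n - 1"
    using dims by simp_all
  \<comment> \<open>Row \<open>i\<close> of the crossing matrix, shifted by one and extended to the columns \<open>0\<close> and \<open>n\<close>.\<close>
  define d where "d k = real (min (Suc i) k) - corner_sum n \<pi> (Suc i) k" for k
  have "d 0 = 0" "d n = 0"
    using i corner_sum_all_columns[OF \<pi>, of "Suc i"] by (simp_all add: d_def)
  have "(crossing_matrix n \<pi> * cartan_matrix n) $$ (i, j) =
      (\<Sum>k<n - 1. crossing_matrix n \<pi> $$ (i, k) * cartan_matrix n $$ (k, j))"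
    using dims i j by (simp add: scalar_prod_def atLeast0LessThan)
  also have "\<dots> = (\<Sum>k<n - 1. d (Suc k) * cartan_matrix n $$ (k, j))"
    using i by (intro sum.cong) (simp_all add: crossing_matrix_entry[OF \<pi>] d_def)
  also have "\<dots> = 2 * d (Suc j) - d j - d (Suc (Suc j))"
    using \<open>d 0 = 0\<close> \<open>d n = 0\<close> j by (rule sum_mult_cartan_matrix)
  also have "\<dots> = (if i = j then 1 else 0) -
      ((\<Sum>a<Suc i. perm_matrix n \<pi> $$ (a, j)) - (\<Sum>a<Suc i. perm_matrix n \<pi> $$ (a, Suc j)))"
    unfolding d_def corner_sum_Suc by (auto simp: min_def)
  also have "\<dots> = (1\<^sub>m (n - 1) - root_coordinate_matrix n (perm_matrix n \<pi>)) $$ (i, j)"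
    using i j by (simp add: root_coordinate_matrix_perm[OF \<pi> n] del: sum.lessThan_Suc)
  finally show "(1\<^sub>m (n - 1) - root_coordinate_matrix n (perm_matrix n \<pi>)) $$ (i, j) =
      (crossing_matrix n \<pi> * cartan_matrix n) $$ (i, j)"
    by (rule sym)
qed

end
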